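(* Let $G$ be a finite simple graph on $n\geq 5$ vertices. Then $\operatorname{dmg}(G;2)=1$ if and only if $G$ is a threshold graph with no more than one isolated vertex.
   Context: All graphs are finite, undirected and simple, and need not be connected. The game with one cop and $s$ robbers on a graph $G$ is a perfect-information game. In round $0$ the cop chooses an initial vertex, and then each robber chooses an initial vertex (several robbers may share a vertex). Each subsequent round consists of a turn for the cop followed by a turn for the robbers; on their turn, each player may stay put or move to a neighboring vertex (on the robbers' turn every uncaptured robber may do so). Whenever the cop occupies the same vertex as one or more robbers, all those robbers are captured and take no further part in the game. If a robber occupies a vertex $v$ at the end of some round (including round $0$) and that robber is not captured in the following round, then $v$ becomes damaged (and stays damaged). The robbers aim to maximize, and the cop aims to minimize, the total number of damaged vertices. The $s$-robber damage number $\operatorname{dmg}(G;s)$ is the number of vertices damaged under optimal play, i.e. the smallest $d$ such that the cop has a strategy guaranteeing that at most $d$ vertices are ever damaged, whatever the $s$ robbers do. A threshold graph is a graph that can be constructed from a single vertex by repeatedly adding either a single isolated vertex or a single dominating vertex (a vertex adjacent to all vertices already present); equivalently, a graph with no induced subgraph on four vertices isomorphic to $P_4$, $C_4$ or $K_2\cup K_2$. *)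

theory Defs
  imports "Graph_Theory.Pair_Digraph"
begin

text \<open>
  A finite simple graph is a \<open>pair_graph\<close>: a finite vertex set with a symmetric,
  irreflexive set of arcs, each edge being represented by its two orientations.
\<close>

definition closed_nbhd :: "'a pair_pre_digraph \<Rightarrow> 'a \<Rightarrow> 'a set" where
  "closed_nbhd G v = insert v {w. (v, w) \<in> parcs G}"

definition isolated_verts :: "'a pair_pre_digraph \<Rightarrow> 'a set" where
  "isolated_verts G = {v \<in> pverts G. \<forall>w. (v, w) \<notin> parcs G}"

inductive threshold_graph :: "'a pair_pre_digraph \<Rightarrow> bool" where
  single: "threshold_graph \<lparr>pverts = {v}, parcs = {}\<rparr>"
| add_isolated:
    "threshold_graph G \<Longrightarrow> v \<notin> pverts G \<Longrightarrow>
     threshold_graph \<lparr>pverts = insert v (pverts G), parcs = parcs G\<rparr>"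
| add_dominating:
    "threshold_graph G \<Longrightarrow> v \<notin> pverts G \<Longrightarrow>
     threshold_graph \<lparr>pverts = insert v (pverts G),
       parcs = parcs G \<union> {v} \<times> pverts G \<union> pverts G \<times> {v}\<rparr>"

text \<open>
  A position is recorded at the end of a round: the cop's vertex, and for every
  robber \<open>i\<close> either \<open>Some\<close> of its vertex, or \<open>None\<close> if it has been captured.
  Only the robbers \<open>i < s\<close> exist; the others are kept at \<open>None\<close>.
\<close>

type_synonym 'a position = "'a \<times> (nat \<Rightarrow> 'a option)"

text \<open>The status of a robber that stands on \<open>w\<close> while the cop is on \<open>c\<close>.\<close>

definition robber_at :: "'a \<Rightarrow> 'a \<Rightarrow> 'a option" where
  "robber_at c w = (if w = c then None else Some w)"

definition initial_placement ::
  "'a pair_pre_digraph \<Rightarrow> nat \<Rightarrow> 'a \<Rightarrow> (nat \<Rightarrow> 'a option) \<Rightarrow> bool" where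
  "initial_placement G s c R \<longleftrightarrow>
     (\<forall>i<s. \<exists>w\<in>pverts G. R i = robber_at c w) \<and> (\<forall>i\<ge>s. R i = None)"

text \<open>
  The robbers pass from \<open>R\<close> to \<open>R'\<close> in a round in which the cop has just moved to \<open>c\<close>:
  a robber already standing on \<open>c\<close> is captured before it can move, and one that
  moves onto \<open>c\<close> is captured as well.
\<close>

definition robbers_turn ::
  "'a pair_pre_digraph \<Rightarrow> 'a \<Rightarrow> (nat \<Rightarrow> 'a option) \<Rightarrow> (nat \<Rightarrow> 'a option) \<Rightarrow> bool" where
  "robbers_turn G c R R' \<longleftrightarrow>
     (\<forall>i. case R i of
            None \<Rightarrow> R' i = None
          | Some u \<Rightarrow> if u = c then R' i = None
                      else \<exists>w\<in>closed_nbhd G u. R' i = robber_at c w)"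

text \<open>
  A cop strategy maps the list of all positions reached so far (oldest first) to the cop's
  next vertex; its value at \<open>[]\<close> is the initial vertex.
\<close>

definition cop_strategy :: "'a pair_pre_digraph \<Rightarrow> ('a position list \<Rightarrow> 'a) \<Rightarrow> bool" where
  "cop_strategy G \<sigma> \<longleftrightarrow>
     \<sigma> [] \<in> pverts G \<and>
     (\<forall>h. h \<noteq> [] \<and> fst (last h) \<in> pverts G \<longrightarrow> \<sigma> h \<in> closed_nbhd G (fst (last h)))"

text \<open>
  \<open>p t\<close> is the position at the end of round \<open>t\<close>. The robbers' choices are unrestricted
  apart from the rules, so quantifying over all such \<open>p\<close> quantifies over everything
  that \<open>s\<close> robbers can do against \<open>\<sigma>\<close>.
\<close>

definition play ::
  "'a pair_pre_digraph \<Rightarrow> nat \<Rightarrow> ('a position list \<Rightarrow> 'a) \<Rightarrow> (nat \<Rightarrow> 'a position) \<Rightarrow> bool" where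
  "play G s \<sigma> p \<longleftrightarrow>
     fst (p 0) = \<sigma> [] \<and> initial_placement G s (fst (p 0)) (snd (p 0)) \<and>
     (\<forall>t. fst (p (Suc t)) = \<sigma> (map p [0..<Suc t]) \<and>
          robbers_turn G (fst (p (Suc t))) (snd (p t)) (snd (p (Suc t))))"

definition damaged :: "(nat \<Rightarrow> 'a position) \<Rightarrow> 'a set" where
  "damaged p = {v. \<exists>t i. snd (p t) i = Some v \<and> snd (p (Suc t)) i \<noteq> None}"

definition dmg :: "'a pair_pre_digraph \<Rightarrow> nat \<Rightarrow> nat" where
  "dmg G s = (LEAST d. \<exists>\<sigma>. cop_strategy G \<sigma> \<and>
                (\<forall>p. play G s \<sigma> p \<longrightarrow> card (damaged p) \<le> d))"

end

theory Submission
  imports Defs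
begin

text \<open>
  Threshold graphs are the graphs in which open neighbourhoods are nested up to the two vertices
  themselves. If \<open>x\<close> and \<open>y\<close> violate this, robbers placed on \<open>x\<close> and \<open>y\<close> damage two vertices: when
  one of them is caught, the other escapes to a private neighbour. Conversely, the cop starts on a
  vertex \<open>z\<close> adjacent to every non-isolated vertex. Of two robbers on \<open>u\<close> and \<open>w\<close> he first catches the
  one with the larger neighbourhood, say on \<open>w\<close>; the other one damages \<open>u\<close>, and is caught as soon as it
  leaves \<open>u\<close>, or else after the cop has returned to \<open>z\<close>.
\<close>

section \<open>Threshold graphs and nested neighbourhoods\<close>

text \<open>This is totality of the vicinal preorder; the closed neighbourhoods on the right
  discount an edge between \<open>u\<close> and \<open>w\<close>. In a simple graph, a failure gives
  edges \<open>u a\<close>, \<open>w b\<close> and non-edges \<open>a w\<close>, \<open>u b\<close>,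
  hence an induced P4, C4 or 2K2.\<close>

definition nested_nbhds :: "'a pair_pre_digraph \<Rightarrow> bool" where
  "nested_nbhds G \<longleftrightarrow>
     (\<forall>u w. parcs G `` {u} \<subseteq> closed_nbhd G w \<or> parcs G `` {w} \<subseteq> closed_nbhd G u)"

lemma pair_graph_sym:
  assumes "pair_graph G" "(u, v) \<in> parcs G"
  shows "(v, u) \<in> parcs G"
  using pair_sym_digraph.pair_sym_arcs[of G] assms
  by (auto simp: symmetric_def sym_def pair_graph_def pair_pseudo_graph_def)

lemma pair_graph_irrefl: "pair_graph G \<Longrightarrow> (u, u) \<notin> parcs G"
  using pair_loopfree_digraph.pair_no_loops[of G "(u, u)"]
  by (auto simp: pair_graph_def pair_digraph_def)

lemma pair_graph_arcD:
  assumes "pair_graph G" "(u, v) \<in> parcs G"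
  shows "u \<in> pverts G" "v \<in> pverts G"
proof -
  interpret pair_graph G by fact
  show "u \<in> pverts G" "v \<in> pverts G" using assms(2) wellformed' by auto
qed

lemma pair_graph_finite: "pair_graph G \<Longrightarrow> finite (pverts G)"
  by (simp add: pair_graph_def pair_digraph_def pair_fin_digraph_def pair_fin_digraph_axioms_def)

lemma threshold_graph_arcs: "threshold_graph G \<Longrightarrow> parcs G \<subseteq> pverts G \<times> pverts G"
  by (induction rule: threshold_graph.induct) auto

lemma threshold_graph_nested_nbhds: "threshold_graph G \<Longrightarrow> nested_nbhds G"
proof (induction rule: threshold_graph.induct)
  case (single v)
  then show ?case by (simp add: nested_nbhds_def)
next
  case (add_isolated G v)
  then show ?case by (simp add: nested_nbhds_def closed_nbhd_def)
next
  case (add_dominating G v)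
  let ?H = "\<lparr>pverts = insert v (pverts G), parcs = parcs G \<union> {v} \<times> pverts G \<union> pverts G \<times> {v}\<rparr>"
  have arcs: "parcs G \<subseteq> pverts G \<times> pverts G"
    using add_dominating by (rule_tac threshold_graph_arcs)
  show ?case
    unfolding nested_nbhds_def
  proof (intro allI)
    fix u w
    consider "u = v" | "w = v" | "u \<noteq> v" "w \<noteq> v" by blast
    then show "parcs ?H `` {u} \<subseteq> closed_nbhd ?H w \<or> parcs ?H `` {w} \<subseteq> closed_nbhd ?H u"
    proof cases
      case 3
      consider "parcs G `` {u} \<subseteq> closed_nbhd G w" | "parcs G `` {w} \<subseteq> closed_nbhd G u"
        using add_dominating.IH by (auto simp: nested_nbhds_def)
      \<comment> \<open>The quantifiers range over the whole type. A vertex outside \<open>G\<close>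
        and distinct from \<open>v\<close> has no neighbours in \<open>?H\<close>, so one inclusion
        is trivial.\<close>
      moreover have ?thesis if "u \<notin> pverts G \<or> w \<notin> pverts G"
        using that 3 arcs by (auto simp: closed_nbhd_def)
      ultimately show ?thesis using 3 by cases (auto simp: closed_nbhd_def)
    qed (use arcs in \<open>auto simp: closed_nbhd_def\<close>)
  qed
qed

text \<open>The dominating vertex added last works, because every vertex added after it stays
  isolated; if there was none, the initial vertex works.\<close>

lemma threshold_graph_hub:
  "threshold_graph G \<Longrightarrow>
     \<exists>z\<in>pverts G. \<forall>v\<in>pverts G. v \<in> isolated_verts G \<or> v \<in> closed_nbhd G z"
proof (induction rule: threshold_graph.induct)
  case (single v)
  then show ?case by (simp add: closed_nbhd_def)
next
  case (add_isolated G v)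
  then show ?case using threshold_graph_arcs[OF add_isolated(1)]
    by (force simp: isolated_verts_def closed_nbhd_def)
next
  case (add_dominating G v)
  show ?case by (rule bexI[of _ v]) (auto simp: closed_nbhd_def)
qed

text \<open>If a vertex \<open>m\<close> of maximal degree is not adjacent to \<open>v\<close>, then \<open>v\<close> has no neighbour \<open>w\<close>: by
  nestedness such a \<open>w\<close> would have larger degree than \<open>m\<close>.\<close>

lemma nested_nbhds_threshold_graph:
  assumes "finite (pverts G)" "pverts G \<noteq> {}" "parcs G \<subseteq> pverts G \<times> pverts G"
    "sym (parcs G)" "irrefl (parcs G)" "nested_nbhds G"
  shows "threshold_graph G"
  using assms
proof (induction "card (pverts G)" arbitrary: G)
  case 0
  then show ?case by simp
next
  case (Suc n)
  note symD' = symD[OF Suc.prems(4)] and irr = Suc.prems(5)[unfolded irrefl_def, rule_format]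
  show ?case
  proof (cases "n = 0")
    case True
    then obtain v where v: "pverts G = {v}" using Suc.hyps(2) by (metis One_nat_def card_1_singletonE)
    then have "parcs G = {}" using Suc.prems(3) irr by auto
    then have "G = \<lparr>pverts = {v}, parcs = {}\<rparr>" using v by simp
    then show ?thesis by (metis threshold_graph.single)
  next
    case False
    let ?del = "\<lambda>x. \<lparr>pverts = pverts G - {x}, parcs = parcs G \<inter> (- {x}) \<times> (- {x})\<rparr>"
    have del: "threshold_graph (?del x)" if "x \<in> pverts G" for x
    proof (rule Suc.hyps(1))
      show card: "n = card (pverts (?del x))" using Suc.hyps(2) Suc.prems(1) that by simp
      show "pverts (?del x) \<noteq> {}" using card False by (metis card.empty)
      show "nested_nbhds (?del x)"
        unfolding nested_nbhds_def
      proof (intro allI)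
        fix u w
        show "parcs (?del x) `` {u} \<subseteq> closed_nbhd (?del x) w \<or>
              parcs (?del x) `` {w} \<subseteq> closed_nbhd (?del x) u"
          using Suc.prems(6)[unfolded nested_nbhds_def, rule_format, of u w]
          by (cases "u = x \<or> w = x") (auto simp: closed_nbhd_def)
      qed
    qed (use Suc.prems in \<open>auto simp: sym_def irrefl_def\<close>)
    define deg where "deg u = card (parcs G `` {u})" for u
    have fin: "finite (parcs G `` {u})" for u
      using Suc.prems(1,3) by (auto intro: finite_subset[of _ "pverts G"])
    obtain m where m: "m \<in> pverts G" "\<And>u. u \<in> pverts G \<Longrightarrow> deg u \<le> deg m"
      using Max_in[of "deg ` pverts G"] Max_ge[of "deg ` pverts G"] Suc.prems(1,2) by fastforce
    \<comment> \<open>Either \<open>m\<close> is dominating, or some vertex is isolated. That vertex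
      is taken as the last one added, and its deletion falls under the induction hypothesis.\<close>
    show ?thesis
    proof (cases "pverts G \<subseteq> closed_nbhd G m")
      case True
      let ?H = "?del m"
      have "G = \<lparr>pverts = insert m (pverts ?H),
          parcs = parcs ?H \<union> {m} \<times> pverts ?H \<union> pverts ?H \<times> {m}\<rparr>"
        using True m(1) Suc.prems(3) irr symD'
        by (intro pair_pre_digraph.equality) (auto simp: closed_nbhd_def)
      then show ?thesis using threshold_graph.add_dominating[OF del[OF m(1)], of m] by simp
    next
      case False
      then obtain v where v: "v \<in> pverts G" "v \<noteq> m" "(m, v) \<notin> parcs G"
        by (auto simp: closed_nbhd_def)
      have iso: "(v, w) \<notin> parcs G" for w
      proof
        assume vw: "(v, w) \<in> parcs G"
        then have w: "w \<in> pverts G" "w \<noteq> m" "(w, v) \<in> parcs G" using Suc.prems(3) v symD' by auto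
        \<comment> \<open>The opposite inclusion fails at \<open>v\<close>, a neighbour of
          \<open>w\<close> outside the closed neighbourhood of \<open>m\<close>.\<close>
        have sub: "parcs G `` {m} \<subseteq> closed_nbhd G w"
          using Suc.prems(6)[unfolded nested_nbhds_def, rule_format, of m w] v w
          by (auto simp: closed_nbhd_def)
        have "deg m < deg w"
        proof (cases "(m, w) \<in> parcs G")
          case True
          \<comment> \<open>Compared with the neighbours of \<open>m\<close>, those of
            \<open>w\<close> lose only \<open>w\<close> and gain both \<open>m\<close> and
            \<open>v\<close>, a net gain of at least one.\<close>
          then have "insert v (insert m (parcs G `` {m} - {w})) \<subseteq> parcs G `` {w}"
            using sub w symD' by (auto simp: closed_nbhd_def)
          then have "card (insert v (insert m (parcs G `` {m} - {w}))) \<le> deg w"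
            unfolding deg_def using fin by (rule_tac card_mono)
          moreover have "card (insert v (insert m (parcs G `` {m} - {w}))) = Suc (deg m)"
            using True v irr fin[of m] card.remove[OF fin[of m], of w] by (simp add: deg_def)
          ultimately show ?thesis by simp
        next
          case False
          then have "parcs G `` {m} \<subset> parcs G `` {w}" using sub w v by (auto simp: closed_nbhd_def)
          then show ?thesis unfolding deg_def using fin by (rule_tac psubset_card_mono)
        qed
        then show False using m(2)[OF w(1)] by simp
      qed
      let ?H = "?del v"
      have "G = \<lparr>pverts = insert v (pverts ?H), parcs = parcs ?H\<rparr>"
        using v iso symD' by (intro pair_pre_digraph.equality) auto
      then show ?thesis using threshold_graph.add_isolated[OF del[OF v(1)], of v] by simp
    qed
  qed
qed

section \<open>Plays and damage numbers\<close>

definition cop_limits :: "'a pair_pre_digraph \<Rightarrow> nat \<Rightarrow> nat \<Rightarrow> bool" where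
  "cop_limits G s d \<longleftrightarrow>
     (\<exists>\<sigma>. cop_strategy G \<sigma> \<and> (\<forall>p. play G s \<sigma> p \<longrightarrow> card (damaged p) \<le> d))"

lemma dmg_eq_Least: "dmg G s = (LEAST d. cop_limits G s d)"
  by (simp add: dmg_def cop_limits_def)

lemma playD:
  assumes "play G s \<sigma> p"
  shows "fst (p 0) = \<sigma> []" "initial_placement G s (fst (p 0)) (snd (p 0))"
    "fst (p (Suc t)) = \<sigma> (map p [0..<Suc t])"
    "robbers_turn G (fst (p (Suc t))) (snd (p t)) (snd (p (Suc t)))"
  using assms unfolding play_def by blast+

lemma cop_strategy_step:
  assumes "cop_strategy G \<sigma>" "play G s \<sigma> p" "fst (p t) \<in> pverts G"
  shows "fst (p (Suc t)) \<in> closed_nbhd G (fst (p t))"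
proof -
  have "map p [0..<Suc t] \<noteq> []" "last (map p [0..<Suc t]) = p t" by simp_all
  then show ?thesis
    using assms(1,3) unfolding playD(3)[OF assms(2)] cop_strategy_def by metis
qed

lemma cop_in_verts:
  assumes "pair_graph G" "cop_strategy G \<sigma>" "play G s \<sigma> p"
  shows "fst (p t) \<in> pverts G"
proof (induction t)
  case 0
  then show ?case using assms by (simp add: play_def cop_strategy_def)
next
  case (Suc t)
  then have "fst (p (Suc t)) \<in> closed_nbhd G (fst (p t))"
    using cop_strategy_step[OF assms(2,3)] by simp
  then show ?case using Suc pair_graph_arcD[OF assms(1)] by (auto simp: closed_nbhd_def)
qed

lemma robber_in_verts:
  assumes "pair_graph G" "play G s \<sigma> p" "snd (p t) i = Some x"
  shows "x \<in> pverts G"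
  using assms(3)
proof (induction t arbitrary: x)
  case 0
  then show ?case using assms(2)
    by (cases "i < s") (auto simp: play_def initial_placement_def robber_at_def split: if_splits)
next
  case (Suc t)
  have "robbers_turn G (fst (p (Suc t))) (snd (p t)) (snd (p (Suc t)))"
    using assms(2) by (rule playD)
  then show ?case
    using Suc pair_graph_arcD(2)[OF assms(1)] unfolding robbers_turn_def
    by (cases "snd (p t) i")
       (fastforce simp: robber_at_def closed_nbhd_def split: if_splits dest!: spec[of _ i])+
qed

lemma damaged_subset_verts:
  assumes "pair_graph G" "play G s \<sigma> p"
  shows "damaged p \<subseteq> pverts G"
  using robber_in_verts[OF assms] by (auto simp: damaged_def)

text \<open>A \<open>LEAST\<close> is attained once some bound exists: a cop who never moves already
  guarantees the number of vertices.\<close>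

lemma cop_limits_dmg:
  assumes G: "pair_graph G" and ne: "pverts G \<noteq> {}"
  shows "cop_limits G s (dmg G s)"
proof -
  obtain z where "z \<in> pverts G" using ne by blast
  then have "cop_strategy G (\<lambda>h. if h = [] then z else fst (last h))"
    by (simp add: cop_strategy_def closed_nbhd_def)
  then have "cop_limits G s (card (pverts G))"
    using damaged_subset_verts[OF G] pair_graph_finite[OF G] unfolding cop_limits_def
    by (meson card_mono)
  then show ?thesis unfolding dmg_eq_Least by (rule LeastI)
qed

text \<open>Lower bounds on the damage need a concrete play against an unknown
  \<open>\<sigma>\<close>. The rule \<open>\<rho>\<close> answers from the round, the cop's new
  vertex and the previous robber placement, and is unfolded against \<open>\<sigma>\<close>.\<close>

lemma play_exists:
  assumes init: "initial_placement G s (\<sigma> []) R0"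
    and turn: "\<And>t c R. robbers_turn G c R (\<rho> t c R)"
  obtains p where "play G s \<sigma> p" "p 0 = (\<sigma> [], R0)"
    "\<And>t. snd (p (Suc t)) = \<rho> t (fst (p (Suc t))) (snd (p t))"
proof -
  \<comment> \<open>Since \<open>\<sigma>\<close> reads the whole history, the recursion builds
    histories; positions are recovered as their last entries.\<close>
  define H where "H = rec_nat [(\<sigma> [], R0)] (\<lambda>t h. h @ [(\<sigma> h, \<rho> t (\<sigma> h) (snd (last h)))])"
  define p where "p t = last (H t)" for t
  have H0: "H 0 = [(\<sigma> [], R0)]"
    and HS: "\<And>t. H (Suc t) = H t @ [(\<sigma> (H t), \<rho> t (\<sigma> (H t)) (snd (last (H t))))]"
    by (simp_all add: H_def)
  have hist: "map p [0..<Suc t] = H t" for t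
  proof (induction t)
    case (Suc t)
    then show ?case by (simp add: HS p_def)
  qed (simp add: p_def H0)
  have pS: "p (Suc t) = (\<sigma> (map p [0..<Suc t]), \<rho> t (\<sigma> (map p [0..<Suc t])) (snd (p t)))" for t
    unfolding hist by (simp add: p_def HS)
  have p0: "p 0 = (\<sigma> [], R0)" by (simp add: p_def H0)
  have "play G s \<sigma> p"
    unfolding play_def using init turn by (simp add: p0 pS del: upt_Suc)
  then show thesis using that p0 by (simp add: pS del: upt_Suc)
qed

section \<open>Strategies for two robbers\<close>

definition move_robber :: "'a \<Rightarrow> 'a \<Rightarrow> 'a \<Rightarrow> 'a option" where
  "move_robber c u w = (if u = c then None else robber_at c w)"

text \<open>The robbers start on \<open>x\<close> and \<open>y\<close>; if one of them is caught in the first round, then the other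
  one moves to \<open>x'\<close> or \<open>y'\<close>, respectively. Nothing else moves.\<close>

lemma two_robbers:
  assumes G: "pair_graph G" and \<sigma>: "cop_strategy G \<sigma>"
    and xy: "x \<in> pverts G" "y \<in> pverts G" "x \<noteq> y" "x \<noteq> \<sigma> []" "y \<noteq> \<sigma> []"
    and x': "x' \<in> closed_nbhd G x" "x' \<noteq> y" and y': "y' \<in> closed_nbhd G y" "y' \<noteq> x"
  obtains p where "play G 2 \<sigma> p"
    "x \<in> damaged p \<or> fst (p 1) = x" "y \<in> damaged p \<or> fst (p 1) = y"
    "fst (p 1) = x \<Longrightarrow> y' \<in> damaged p \<or> y' \<in> closed_nbhd G x"
    "fst (p 1) = y \<Longrightarrow> x' \<in> damaged p \<or> x' \<in> closed_nbhd G y"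
proof -
  define go where "go t c u =
    (if t = (0::nat) \<and> c = x \<and> u = y then y' else if t = 0 \<and> c = y \<and> u = x then x' else u)" for t c u
  define \<rho> where "\<rho> t c R = (\<lambda>i::nat. case R i of None \<Rightarrow> None | Some u \<Rightarrow> move_robber c u (go t c u))"
    for t c R
  define R0 where "R0 i = (if i = 0 then Some x else if i = Suc 0 then Some y else None)" for i :: nat
  have init: "initial_placement G 2 (\<sigma> []) R0"
    using xy by (auto simp: initial_placement_def R0_def robber_at_def)
  have turn: "robbers_turn G c R (\<rho> t c R)" for t c R
  proof -
    have "go t c u \<in> closed_nbhd G u" for u
      using x'(1) y'(1) by (simp add: go_def closed_nbhd_def)
    then show ?thesis
      unfolding robbers_turn_def \<rho>_def move_robber_def by (auto split: option.split)
  qed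
  obtain p where p: "play G 2 \<sigma> p" "p 0 = (\<sigma> [], R0)"
    "\<And>t. snd (p (Suc t)) = \<rho> t (fst (p (Suc t))) (snd (p t))"
    using play_exists[of G 2 \<sigma> R0 \<rho>, OF init turn] by metis
  have moves: "fst (p (Suc t)) \<in> closed_nbhd G (fst (p t))" for t
    using cop_strategy_step[OF \<sigma> p(1) cop_in_verts[OF G \<sigma> p(1)]] .
  have dam: "u \<in> damaged p" if "snd (p t) i = Some u" "snd (p (Suc t)) i \<noteq> None" for t i u
    using that unfolding damaged_def by blast
  define c1 c2 where "c1 = fst (p 1)" and "c2 = fst (p (Suc 1))"
  have r1: "snd (p 1) = \<rho> 0 c1 R0" using p(3)[of 0] p(2) by (simp add: c1_def)
  have r2: "snd (p (Suc 1)) = \<rho> 1 c2 (snd (p 1))" using p(3)[of 1] by (simp add: c2_def)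
  \<comment> \<open>The robber on \<open>x\<close> moves in this round only if the cop is on
    \<open>y\<close>, and then \<open>x' \<noteq> y\<close> keeps it from running into him.\<close>
  have "x \<in> damaged p \<or> c1 = x"
    using dam[of 0 0 x] r1 p(2) xy x'
    by (auto simp: R0_def \<rho>_def move_robber_def robber_at_def go_def split: if_splits)
  moreover have "y \<in> damaged p \<or> c1 = y"
    using dam[of 0 1 y] r1 p(2) xy y'
    by (auto simp: R0_def \<rho>_def move_robber_def robber_at_def go_def split: if_splits)
  moreover have "y' \<in> damaged p \<or> y' \<in> closed_nbhd G x" if "c1 = x"
  proof -
    have "snd (p 1) 1 = Some y'"
      using that r1 xy y' by (simp add: R0_def \<rho>_def move_robber_def robber_at_def go_def)
    then have "y' \<in> damaged p \<or> c2 = y'"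
      using dam[of 1 1 y'] r2 by (auto simp: \<rho>_def move_robber_def robber_at_def go_def split: if_splits)
    \<comment> \<open>The cop stands on \<open>x\<close> after round 1, so he can be on
      \<open>y'\<close> in round 2 only if \<open>y'\<close> is in the closed neighbourhood of
      \<open>x\<close>.\<close>
    then show ?thesis using moves[of 1] that by (auto simp: c1_def c2_def)
  qed
  moreover have "x' \<in> damaged p \<or> x' \<in> closed_nbhd G y" if "c1 = y"
  proof -
    have "snd (p 1) 0 = Some x'"
      using that r1 xy x' by (simp add: R0_def \<rho>_def move_robber_def robber_at_def go_def)
    then have "x' \<in> damaged p \<or> c2 = x'"
      using dam[of 1 0 x'] r2 by (auto simp: \<rho>_def move_robber_def robber_at_def go_def split: if_splits)
    then show ?thesis using moves[of 1] that by (auto simp: c1_def c2_def)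
  qed
  ultimately show thesis using that p(1) by (simp add: c1_def)
qed

lemma finite_damaged:
  assumes "pair_graph G" "play G s \<sigma> p"
  shows "finite (damaged p)"
  using damaged_subset_verts[OF assms] pair_graph_finite[OF assms(1)] by (rule finite_subset)

lemma two_damaged:
  assumes "finite D" "a \<in> D" "b \<in> D" "a \<noteq> b"
  shows "\<not> card D \<le> Suc 0"
  using assms card_le_Suc0_iff_eq by blast

lemma two_others:
  assumes "card A \<ge> 3"
  obtains x y where "x \<in> A" "y \<in> A" "x \<noteq> y" "x \<noteq> z" "y \<noteq> z"
proof -
  have "2 \<le> card (A - {z})" using assms by (simp add: card_Diff_singleton_if) linarith
  then obtain B where "B \<subseteq> A - {z}" "card B = 2" by (metis obtain_subset_with_card_n)
  then show thesis using that by (auto simp: card_2_iff)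
qed

text \<open>Two robbers who stay on distinct vertices away from the cop's start cannot both be
  caught in the first round.\<close>

lemma not_cop_limits_0:
  assumes G: "pair_graph G" and card: "card (pverts G) \<ge> 3"
  shows "\<not> cop_limits G 2 0"
proof
  assume "cop_limits G 2 0"
  then obtain \<sigma> where \<sigma>: "cop_strategy G \<sigma>" "\<And>p. play G 2 \<sigma> p \<Longrightarrow> card (damaged p) = 0"
    by (auto simp: cop_limits_def)
  obtain x y where "x \<in> pverts G" "y \<in> pverts G" "x \<noteq> y" "x \<noteq> \<sigma> []" "y \<noteq> \<sigma> []"
    using two_others[OF card] by metis
  then obtain p where "play G 2 \<sigma> p" "x \<in> damaged p \<or> fst (p 1) = x" "y \<in> damaged p \<or> fst (p 1) = y"
    using two_robbers[OF G \<sigma>(1), of x y x y] by (auto simp: closed_nbhd_def)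
  then show False using \<sigma>(2) finite_damaged[OF G] \<open>x \<noteq> y\<close> by fastforce
qed

lemma cop_limits_1_nested_nbhds:
  assumes G: "pair_graph G" and lim: "cop_limits G 2 1"
  shows "nested_nbhds G"
proof (rule ccontr)
  assume "\<not> nested_nbhds G"
  then obtain u w a b where *: "(u, a) \<in> parcs G" "a \<notin> closed_nbhd G w"
      "(w, b) \<in> parcs G" "b \<notin> closed_nbhd G u"
    by (auto simp: nested_nbhds_def)
  obtain \<sigma> where \<sigma>: "cop_strategy G \<sigma>" "\<And>p. play G 2 \<sigma> p \<Longrightarrow> card (damaged p) \<le> Suc 0"
    using lim by (auto simp: cop_limits_def)
  have win: False
    if h: "(x, x') \<in> parcs G" "x' \<notin> closed_nbhd G y" "(y, y') \<in> parcs G" "y' \<notin> closed_nbhd G x"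
      "\<sigma> [] \<noteq> x" "\<sigma> [] \<noteq> y" for x x' y y'
  proof -
    have ne: "x \<noteq> y" "x' \<noteq> y" "y' \<noteq> x" "x \<noteq> x'" "y \<noteq> y'"
      using h pair_graph_irrefl[OF G] by (auto simp: closed_nbhd_def)
    obtain p where p: "play G 2 \<sigma> p" "x \<in> damaged p \<or> fst (p 1) = x" "y \<in> damaged p \<or> fst (p 1) = y"
      "fst (p 1) = x \<Longrightarrow> y' \<in> damaged p \<or> y' \<in> closed_nbhd G x"
      "fst (p 1) = y \<Longrightarrow> x' \<in> damaged p \<or> x' \<in> closed_nbhd G y"
      using two_robbers[OF G \<sigma>(1), of x y x' y'] h ne pair_graph_arcD[OF G]
      by (auto simp: closed_nbhd_def)
    \<comment> \<open>The damaged pair is \<open>y\<close>, \<open>y'\<close> after a first capture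
      on \<open>x\<close>, then \<open>x\<close>, \<open>x'\<close> after one on \<open>y\<close>,
      and \<open>x\<close>, \<open>y\<close> otherwise.\<close>
    show False
      using two_damaged[OF finite_damaged[OF G p(1)]] \<sigma>(2)[OF p(1)] p(2-5) ne h by metis
  qed
  show False
  proof (cases "\<sigma> [] \<in> {u, w}")
    \<comment> \<open>The violation is symmetric: \<open>a\<close> and \<open>b\<close> also violate
      nestedness, with \<open>u\<close> and \<open>w\<close> as their private neighbours. A cop
      starting on \<open>u\<close> or \<open>w\<close> is on neither \<open>a\<close> nor
      \<open>b\<close>.\<close>
    case True
    then show False
      using win[of a u b w] * pair_graph_sym[OF G] pair_graph_irrefl[OF G]
      by (auto simp: closed_nbhd_def)
  next
    case False
    then show False using win[of u a w b] * by auto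
  qed
qed

text \<open>Two robbers out of reach of the cop's first move damage both their vertices by staying.
  If the cop starts on \<open>a\<close> or \<open>b\<close>, he cannot move and any two other
  vertices serve; otherwise \<open>a\<close> and \<open>b\<close> themselves do.\<close>

lemma cop_limits_1_isolated:
  assumes G: "pair_graph G" and card: "card (pverts G) \<ge> 3" and lim: "cop_limits G 2 1"
  shows "card (isolated_verts G) \<le> 1"
proof (rule ccontr)
  assume "\<not> card (isolated_verts G) \<le> 1"
  then obtain a b where ab: "a \<in> isolated_verts G" "b \<in> isolated_verts G" "a \<noteq> b"
    by (metis card_le_Suc0_iff_eq One_nat_def card.infinite zero_le)
  obtain \<sigma> where \<sigma>: "cop_strategy G \<sigma>" "\<And>p. play G 2 \<sigma> p \<Longrightarrow> card (damaged p) \<le> Suc 0"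
    using lim by (auto simp: cop_limits_def)
  have z: "\<sigma> [] \<in> pverts G" using \<sigma>(1) by (simp add: cop_strategy_def)
  obtain c d where cd: "c \<in> pverts G" "d \<in> pverts G" "c \<noteq> d" "c \<noteq> \<sigma> []" "d \<noteq> \<sigma> []"
    using two_others[OF card] by metis
  obtain x y where xy: "x \<in> pverts G" "y \<in> pverts G" "x \<noteq> y" "x \<noteq> \<sigma> []" "y \<noteq> \<sigma> []"
    "x \<notin> closed_nbhd G (\<sigma> [])" "y \<notin> closed_nbhd G (\<sigma> [])"
  proof (cases "\<sigma> [] \<in> {a, b}")
    case True
    then show thesis using that[of c d] cd ab by (auto simp: isolated_verts_def closed_nbhd_def)
  next
    case False
    then show thesis using that[of a b] ab pair_graph_sym[OF G, of "\<sigma> []"]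
      by (auto simp: isolated_verts_def closed_nbhd_def)
  qed
  then obtain p where p: "play G 2 \<sigma> p" "x \<in> damaged p \<or> fst (p 1) = x" "y \<in> damaged p \<or> fst (p 1) = y"
    using two_robbers[OF G \<sigma>(1), of x y x y] by (auto simp: closed_nbhd_def)
  have "fst (p 1) \<in> closed_nbhd G (\<sigma> [])"
    using cop_strategy_step[OF \<sigma>(1) p(1), of 0] playD(1)[OF p(1)] z by simp
  then show False
    using two_damaged[OF finite_damaged[OF G p(1)]] \<sigma>(2)[OF p(1)] p(2,3) xy by metis
qed

section \<open>The strategy of the cop\<close>

definition prey :: "'a pair_pre_digraph \<Rightarrow> 'a \<Rightarrow> (nat \<Rightarrow> 'a option) \<Rightarrow> 'a set" where
  "prey G c R = {x. (\<exists>i. R i = Some x) \<and> (c, x) \<in> parcs G}"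

text \<open>After a capture on such an \<open>x\<close>, a robber that leaves the vertex of any
  other prey lands next to the cop or on him.\<close>

definition best_prey :: "'a pair_pre_digraph \<Rightarrow> 'a \<Rightarrow> (nat \<Rightarrow> 'a option) \<Rightarrow> 'a \<Rightarrow> bool" where
  "best_prey G c R x \<longleftrightarrow>
     x \<in> prey G c R \<and> (\<forall>y\<in>prey G c R. parcs G `` {y} \<subseteq> closed_nbhd G x)"

text \<open>The return to \<open>z\<close> is what ends a \<open>lurking\<close> position; staying
  on \<open>c\<close> is a legal default when \<open>z\<close> is out of reach.\<close>

definition chase :: "'a pair_pre_digraph \<Rightarrow> 'a \<Rightarrow> 'a \<Rightarrow> (nat \<Rightarrow> 'a option) \<Rightarrow> 'a" where
  "chase G z c R =
     (if \<exists>x. best_prey G c R x then SOME x. best_prey G c R x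
      else if z \<in> closed_nbhd G c then z else c)"

definition pursuit :: "'a pair_pre_digraph \<Rightarrow> 'a \<Rightarrow> 'a position list \<Rightarrow> 'a" where
  "pursuit G z h = (if h = [] then z else chase G z (fst (last h)) (snd (last h)))"

lemma best_prey_chase: "best_prey G c R x \<Longrightarrow> best_prey G c R (chase G z c R)"
  by (auto simp: chase_def intro: someI)

lemma cop_strategy_pursuit: "z \<in> pverts G \<Longrightarrow> cop_strategy G (pursuit G z)"
proof -
  have "chase G z c R \<in> closed_nbhd G c" for c R
  proof (cases "\<exists>x. best_prey G c R x")
    case True
    then have "best_prey G c R (chase G z c R)" by (auto intro: best_prey_chase)
    then show ?thesis by (simp add: best_prey_def prey_def closed_nbhd_def)
  qed (auto simp: chase_def closed_nbhd_def)
  then show "z \<in> pverts G \<Longrightarrow> ?thesis" by (simp add: cop_strategy_def pursuit_def)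
qed

text \<open>Once \<open>v\<close> is the only vertex ever to be damaged, each robber is either stuck on \<open>v\<close> for good or
  about to be caught (\<open>cornered\<close>), or the last robber lurks on \<open>v\<close> until the cop gets back to \<open>z\<close>.\<close>

definition cornered :: "'a pair_pre_digraph \<Rightarrow> 'a \<Rightarrow> 'a \<Rightarrow> (nat \<Rightarrow> 'a option) \<Rightarrow> bool" where
  "cornered G v c R \<longleftrightarrow>
     (\<forall>i x. R i = Some x \<longrightarrow> (c, x) \<in> parcs G \<or> x \<in> isolated_verts G \<and> x = v) \<and>
     (\<forall>x\<in>prey G c R. \<forall>y\<in>prey G c R. x = y)"

definition lurking :: "'a pair_pre_digraph \<Rightarrow> 'a \<Rightarrow> 'a \<Rightarrow> 'a \<Rightarrow> (nat \<Rightarrow> 'a option) \<Rightarrow> bool" where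
  "lurking G z v c R \<longleftrightarrow>
     (c, z) \<in> parcs G \<and> (v, z) \<in> parcs G \<and> (c, v) \<notin> parcs G \<and>
     (\<forall>i x. R i = Some x \<longrightarrow> x = v) \<and>
     (\<forall>i j. R i \<noteq> None \<longrightarrow> R j \<noteq> None \<longrightarrow> i = j)"

lemma robbers_turnD:
  assumes "robbers_turn G c R R'" "R' i = Some y"
  obtains x where "R i = Some x" "x \<noteq> c" "y \<noteq> c" "y \<in> closed_nbhd G x"
  using assms unfolding robbers_turn_def
  by (cases "R i") (auto simp: robber_at_def split: if_splits dest!: spec[of _ i])

text \<open>All prey share one vertex, which is therefore the only best prey, and the cop catches
  everyone there. The survivors sit on the isolated vertex \<open>v\<close> and cannot leave
  it.\<close>

lemma cornered_step:
  assumes "cornered G v c R" and turn: "robbers_turn G (chase G z c R) R R'"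
  shows "cornered G v (chase G z c R) R'" "R i = Some x \<Longrightarrow> R' i \<noteq> None \<Longrightarrow> x = v"
proof -
  have stuck: "x = v \<and> x \<in> isolated_verts G \<and> y = v" if y: "R' i = Some y" and x: "R i = Some x" for i x y
  proof -
    obtain "x \<noteq> chase G z c R" and xy: "y \<in> closed_nbhd G x"
      using robbers_turnD[OF turn y] x by auto
    have "x \<notin> prey G c R"
    proof
      assume "x \<in> prey G c R"
      then have *: "best_prey G c R w \<longleftrightarrow> w = x" for w
        using assms(1) by (auto simp: best_prey_def cornered_def closed_nbhd_def)
      then show False using best_prey_chase[of G c R x z] \<open>x \<noteq> chase G z c R\<close> by simp
    qed
    then have "x \<in> isolated_verts G \<and> x = v"
      using assms(1) x by (auto simp: cornered_def prey_def)
    then show ?thesis using xy by (auto simp: isolated_verts_def closed_nbhd_def)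
  qed
  show "x = v" if "R i = Some x" "R' i \<noteq> None" using that stuck by blast
  have all: "y \<in> isolated_verts G \<and> y = v" if "R' i = Some y" for i y
    using robbers_turnD[OF turn that] stuck[OF that] by metis
  then show "cornered G v (chase G z c R) R'"
    by (auto simp: cornered_def prey_def)
qed

text \<open>With no prey in reach the cop returns to \<open>z\<close>. The one remaining robber ends
  on \<open>v\<close> or on a neighbour of \<open>v\<close>, so on a non-isolated vertex; there it
  is adjacent to \<open>z\<close>, unless it ran into the cop.\<close>

lemma lurking_step:
  assumes G: "pair_graph G"
    and hub: "\<And>v. v \<in> pverts G \<Longrightarrow> v \<in> isolated_verts G \<or> v \<in> closed_nbhd G z"
    and lurk: "lurking G z v c R" and turn: "robbers_turn G (chase G z c R) R R'"
  shows "cornered G v (chase G z c R) R'" "R i = Some x \<Longrightarrow> R' i \<noteq> None \<Longrightarrow> x = v"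
proof -
  show "x = v" if "R i = Some x" using lurk that by (auto simp: lurking_def)
  have "prey G c R = {}" using lurk by (auto simp: lurking_def prey_def)
  then have z: "chase G z c R = z"
    using lurk by (auto simp: chase_def best_prey_def lurking_def closed_nbhd_def)
  have "(z, y) \<in> parcs G" if y: "R' i = Some y" for i y
  proof -
    obtain x where x: "R i = Some x" "y \<noteq> z" "y \<in> closed_nbhd G x"
      using robbers_turnD[OF turn y] z by metis
    then have "(v, y) \<in> parcs G \<or> y = v" using lurk by (auto simp: lurking_def closed_nbhd_def)
    \<comment> \<open>If \<open>y = v\<close>, then \<open>z\<close> is a neighbour of
      \<open>y\<close>; otherwise \<open>v\<close> is.\<close>
    then have "y \<in> pverts G" "y \<notin> isolated_verts G"
      using lurk pair_graph_arcD[OF G] pair_graph_sym[OF G, of v y]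
      by (auto simp: lurking_def isolated_verts_def)
    then show ?thesis using hub x(2) by (auto simp: closed_nbhd_def)
  qed
  moreover have "i = j" if "R' i \<noteq> None" "R' j \<noteq> None" for i j
    using robbers_turnD[OF turn] lurk that unfolding lurking_def by (metis not_None_eq)
  ultimately show "cornered G v (chase G z c R) R'"
    unfolding z cornered_def prey_def by (auto, metis option.distinct(1) option.inject)
qed

text \<open>Nestedness makes one of \<open>a\<close>, \<open>b\<close> a best prey \<open>w\<close>;
  the cop catches the robber there. The other one, on \<open>u\<close>, ends adjacent to
  \<open>w\<close>, gets caught, or stays on \<open>u\<close> out of reach. The first two outcomes
  are \<open>cornered\<close>, the last is \<open>lurking\<close>, and only \<open>u\<close> can be
  damaged.\<close>

lemma two_prey_step:
  assumes G: "pair_graph G"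
    and hub: "\<And>v. v \<in> pverts G \<Longrightarrow> v \<in> isolated_verts G \<or> v \<in> closed_nbhd G z"
    and nested: "nested_nbhds G"
    and R: "\<And>i x. R i = Some x \<Longrightarrow> i < 2" "R 0 = Some a" "R 1 = Some b"
    and ab: "(z, a) \<in> parcs G" "(z, b) \<in> parcs G" "a \<noteq> b"
    and turn: "robbers_turn G (chase G z z R) R R'"
  obtains v where "cornered G v (chase G z z R) R' \<or> lurking G z v (chase G z z R) R'"
    "\<And>i x. R i = Some x \<Longrightarrow> R' i \<noteq> None \<Longrightarrow> x = v"
proof -
  define w where "w = chase G z z R"
  have R_cases: "i = 0 \<and> x = a \<or> i = 1 \<and> x = b" if "R i = Some x" for i x
    using R(1)[OF that] R(2,3) that by (auto simp: less_2_cases_iff)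
  have prey: "prey G z R = {a, b}"
    using R_cases R(2,3) ab by (auto simp: prey_def)
  have "best_prey G z R a \<or> best_prey G z R b"
    using nested prey by (auto simp: nested_nbhds_def best_prey_def closed_nbhd_def)
  then have best: "best_prey G z R w" unfolding w_def using best_prey_chase by metis
  then have wab: "w = a \<or> w = b" using prey by (simp add: best_prey_def)
  define u where "u = (if w = a then b else a)"
  define k :: nat where "k = (if w = a then 1 else 0)"
  have other: "i = k \<and> x = u" if "R i = Some x" "x \<noteq> w" for i x
    using R_cases[OF that(1)] that(2) wab ab(3) by (auto simp: u_def k_def)
  have sub: "parcs G `` {u} \<subseteq> closed_nbhd G w"
    using best prey by (auto simp: best_prey_def u_def)
  have zu: "(z, u) \<in> parcs G" and zw: "(z, w) \<in> parcs G" using ab wab by (auto simp: u_def)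
  have single: "i = k \<and> y \<noteq> w \<and> y \<in> closed_nbhd G u" if "R' i = Some y" for i y
    using robbers_turnD[OF turn that] other unfolding w_def by metis
  have dam: "x = u" if Rx: "R i = Some x" and "R' i \<noteq> None" for i x
  proof -
    obtain y where "R' i = Some y" using \<open>R' i \<noteq> None\<close> by blast
    then have "x \<noteq> w" using robbers_turnD[OF turn] Rx unfolding w_def by (metis option.inject)
    then show ?thesis using other Rx by blast
  qed
  have "cornered G u w R' \<or> lurking G z u w R'"
  proof (cases "\<exists>y. R' k = Some y \<and> (w, y) \<notin> parcs G")
    case True
    then obtain y where y: "R' k = Some y" "(w, y) \<notin> parcs G" by blast
    \<comment> \<open>Had the robber left \<open>u\<close>, it would be in the closed neighbourhood
      of \<open>w\<close> by \<open>sub\<close>, so adjacent to \<open>w\<close> or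
      captured.\<close>
    then have "y = u" using single[OF y(1)] sub by (auto simp: closed_nbhd_def)
    then have "lurking G z u w R'"
      unfolding lurking_def using single y zu zw pair_graph_sym[OF G]
      by (metis (no_types, lifting) not_None_eq option.inject)
    then show ?thesis ..
  next
    case False
    then have "cornered G u w R'"
      unfolding cornered_def prey_def using single by (auto, metis option.inject)
    then show ?thesis ..
  qed
  then show thesis using that[of u] dam unfolding w_def by blast
qed

lemma threshold_graph_cop_limits_1:
  assumes G: "pair_graph G" and thr: "threshold_graph G" and iso: "card (isolated_verts G) \<le> 1"
  shows "cop_limits G 2 1"
proof -
  obtain z where z: "z \<in> pverts G"
    and hub: "\<And>v. v \<in> pverts G \<Longrightarrow> v \<in> isolated_verts G \<or> v \<in> closed_nbhd G z"
    using threshold_graph_hub[OF thr] by blast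
  have "finite (isolated_verts G)"
    using pair_graph_finite[OF G] by (simp add: isolated_verts_def)
  then have iso_eq: "x = y" if "x \<in> isolated_verts G" "y \<in> isolated_verts G" for x y
    using iso that card_le_Suc0_iff_eq by (metis One_nat_def)
  have "card (damaged p) \<le> 1" if play: "play G 2 (pursuit G z) p" for p
  proof -
    define c R where "c t = fst (p t)" and "R t = snd (p t)" for t
    have c0: "c 0 = z" using playD(1)[OF play] by (simp add: pursuit_def c_def)
    have cS: "c (Suc t) = chase G z (c t) (R t)" for t
      using playD(3)[OF play, of t] by (simp add: pursuit_def c_def R_def)
    have turn: "robbers_turn G (chase G z (c t) (R t)) (R t) (R (Suc t))" for t
      using playD(4)[OF play, of t] cS[of t] by (simp add: c_def R_def)
    have place: "initial_placement G 2 z (R 0)"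
      using playD(2)[OF play] c0 by (simp add: c_def R_def)
    define safe where "safe v t \<longleftrightarrow> cornered G v (c t) (R t) \<or> lurking G z v (c t) (R t)" for v t
    define only where "only v t \<longleftrightarrow> (\<forall>i x. R t i = Some x \<longrightarrow> R (Suc t) i \<noteq> None \<longrightarrow> x = v)" for v t
    have step: "safe v (Suc t) \<and> only v t" if "safe v t" for v t
      using that cornered_step[OF _ turn] lurking_step[OF G hub _ turn]
      unfolding safe_def only_def cS by metis
    \<comment> \<open>The invariant is required only from round 1 on, since a start with two
      distinct prey is not yet safe; what the first round damages is a separate premise.\<close>
    have bound: "card (damaged p) \<le> 1" if "safe v (Suc 0)" "only v 0" for v
    proof -
      have "safe v (Suc t)" for t using that step by (induction t) auto
      then have "only v t" for t using that step by (cases t) auto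
      then have "damaged p \<subseteq> {v}" by (auto simp: damaged_def only_def R_def)
      then show ?thesis using card_mono[of "{v}"] by fastforce
    qed
    have start: "i < 2 \<and> ((z, x) \<in> parcs G \<or> x \<in> isolated_verts G)" if "R 0 i = Some x" for i x
      using place that hub unfolding initial_placement_def
      by (cases "i < 2") (fastforce simp: robber_at_def closed_nbhd_def split: if_splits)+
    show ?thesis
    proof (cases "\<exists>x\<in>prey G z (R 0). \<exists>y\<in>prey G z (R 0). x \<noteq> y")
      case True
      then obtain i j x y where ij: "R 0 i = Some x" "R 0 j = Some y" "x \<noteq> y"
        "(z, x) \<in> parcs G" "(z, y) \<in> parcs G"
        by (auto simp: prey_def)
      then have "i < 2" "j < 2" "i \<noteq> j" using start by auto
      then have "i = 0 \<and> j = 1 \<or> i = 1 \<and> j = 0" by auto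
      then obtain a b where ab: "R 0 0 = Some a" "R 0 1 = Some b" "a \<noteq> b"
        "(z, a) \<in> parcs G" "(z, b) \<in> parcs G"
        using ij by metis
      obtain v where "safe v (Suc 0)" "only v 0"
        using two_prey_step[OF G hub threshold_graph_nested_nbhds[OF thr], of "R 0" a b "R (Suc 0)"]
          start ab turn[of 0] cS[of 0] c0 unfolding safe_def only_def by metis
      then show ?thesis by (rule bound)
    next
      case False
      \<comment> \<open>At most one vertex is isolated, so all robbers that are not prey share it.
        If there is none, \<open>v\<close> is arbitrary, and every robber present is prey on one
        vertex.\<close>
      define v where "v = (SOME v. v \<in> isolated_verts G)"
      have "x = v" if "x \<in> isolated_verts G" for x
        using that iso_eq someI[of "\<lambda>v. v \<in> isolated_verts G"] unfolding v_def by metis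
      then have "safe v 0"
        unfolding safe_def cornered_def c0 using start False by blast
      then show ?thesis using step bound by blast
    qed
  qed
  then show ?thesis using cop_strategy_pursuit[OF z] unfolding cop_limits_def by blast
qed

theorem theorem4p3:
  fixes G :: "'a pair_pre_digraph"
  assumes "pair_graph G"
    and "card (pverts G) \<ge> 5"
  shows "dmg G 2 = 1 \<longleftrightarrow> threshold_graph G \<and> card (isolated_verts G) \<le> 1"
proof
  note G = assms(1)
  assume "dmg G 2 = 1"
  then have lim: "cop_limits G 2 1" using cop_limits_dmg[OF G, of 2] assms(2) by fastforce
  have "threshold_graph G"
  proof (rule nested_nbhds_threshold_graph)
    show "nested_nbhds G" using G lim by (rule cop_limits_1_nested_nbhds)
    show "parcs G \<subseteq> pverts G \<times> pverts G" using pair_graph_arcD[OF G] by auto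
    show "sym (parcs G)" using pair_graph_sym[OF G] by (auto simp: sym_def)
    show "irrefl (parcs G)" using pair_graph_irrefl[OF G] by (auto simp: irrefl_def)
    show "finite (pverts G)" using G by (rule pair_graph_finite)
    show "pverts G \<noteq> {}" using assms(2) by auto
  qed
  then show "threshold_graph G \<and> card (isolated_verts G) \<le> 1"
    using cop_limits_1_isolated[OF G _ lim] assms(2) by simp
next
  note G = assms(1)
  assume "threshold_graph G \<and> card (isolated_verts G) \<le> 1"
  then have "cop_limits G 2 1" using threshold_graph_cop_limits_1[OF G] by blast
  moreover have "\<not> cop_limits G 2 0" using not_cop_limits_0[OF G] assms(2) by simp
  ultimately show "dmg G 2 = 1"
    unfolding dmg_eq_Least
    by (intro Least_equality) (metis One_nat_def Suc_leI gr0I)+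
qed

end
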